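(* Suppose that there exist constants $C_0\ge1$ and $d$ with $1\le d<C_0$ such that for all sufficiently large real $x$ there is an integer $m\in\big(x-(\log\frac{x}{2})^d,\,x\big]$ with $\omega(m)\ge C_0\log\log m/\log\log\log m$. Then there exists $\delta>0$ such that for every sufficiently large integer $n$ there exists an integer $k$ with $1\ll k<n$ and $\omega(n-k)>(1+\delta)\log k/\log\log k$.
   Context: $\omega(m)$ is the number of distinct prime factors of $m$. "$1\ll k$" means $k$ is at least a suitable absolute constant. The hypothesis is the paper's Conjecture on short intervals containing integers with many prime factors. *)

theory Defs
  imports Complex_Main "HOL-Computational_Algebra.Primes"
begin

definition omega :: "int \<Rightarrow> nat" where
  "omega m = card (prime_factors m)"

end

theory Submission
  imports Defs "HOL-Real_Asymp.Real_Asymp"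
begin

text \<open>
  For large \<open>n\<close> apply the hypothesis at \<open>x = n - c\<close> with a constant \<open>c \<ge> K\<close> and put \<open>k = n - m\<close>.
  Then \<open>c \<le> k < c + (ln n) powr d\<close>, so \<open>ln k\<close> is at most \<open>D * ln (ln n)\<close> for any fixed \<open>D > d\<close>.
  As \<open>t / ln t\<close> increases for \<open>t \<ge> exp 1\<close>, \<open>ln k / ln (ln k)\<close> is at most
  \<open>D * ln (ln n) / ln (ln (ln n))\<close>, whereas \<open>m \<ge> n / 2\<close> makes \<open>omega m\<close> at least
  \<open>(C0 - o(1)) * ln (ln n) / ln (ln (ln n))\<close>; since \<open>d < C0\<close> there is room for a factor \<open>1 + \<delta>\<close>.
\<close>

text \<open>The derivative \<open>(ln x - 1) / (ln x)\<^sup>2\<close> is nonnegative as soon as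
  \<open>ln x\<close> is at least 1.\<close>

lemma divide_ln_mono:
  fixes s t :: real
  assumes "exp 1 \<le> s" "s \<le> t"
  shows "s / ln s \<le> t / ln t"
proof (rule DERIV_nonneg_imp_nondecreasing[OF assms(2)])
  fix x assume x: "s \<le> x" "x \<le> t"
  have x1: "exp 1 \<le> x" using x assms by linarith
  have x0: "0 < x" using x1 exp_gt_zero[of "1::real"] by linarith
  have ln1: "1 \<le> ln x" using x1 x0 by (simp add: ln_ge_iff)
  have "((\<lambda>t. t / ln t) has_real_derivative ((ln x - 1) / (ln x)\<^sup>2)) (at x)"
    using x0 ln1 by (auto intro!: derivative_eq_intros simp: power2_eq_square)
  then show "\<exists>y. ((\<lambda>t. t / ln t) has_real_derivative y) (at x) \<and> 0 \<le> y"
    using ln1 by (intro exI conjI) auto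
qed

text \<open>Since e is at most 3, 27 = 3^3 is at least e^3, so its logarithm is at least 3. This
  puts \<open>ln k\<close> in the range of \<open>divide_ln_mono\<close>.\<close>

lemma exp_1_le_ln:
  fixes x :: real
  assumes "27 \<le> x"
  shows "exp 1 \<le> ln x"
proof -
  have "exp (1::real) \<le> 3" by (rule exp_le)
  also have "3 \<le> ln x"
  proof -
    have "exp (3::real) = exp 1 ^ 3" by (simp flip: exp_of_nat_mult)
    also have "\<dots> \<le> 3 ^ 3" by (intro power_mono exp_le) auto
    finally show ?thesis using assms by (simp add: ln_ge_iff)
  qed
  finally show ?thesis .
qed

theorem theorem4:
  assumes "\<exists>(C0::real) (d::real). C0 \<ge> 1 \<and> 1 \<le> d \<and> d < C0 \<and>
    (\<forall>\<^sub>F x::real in at_top. \<exists>m::int.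
        x - (ln (x / 2)) powr d < of_int m \<and> of_int m \<le> x \<and>
        real (omega m) \<ge> C0 * ln (ln (of_int m)) / ln (ln (ln (of_int m))))"
  shows "\<exists>\<delta>::real. \<delta> > 0 \<and>
    (\<forall>K::int. \<forall>\<^sub>F n::int in at_top. \<exists>k::int.
        K \<le> k \<and> k < n \<and>
        real (omega (n - k)) > (1 + \<delta>) * ln (of_int k) / ln (ln (of_int k)))"
proof -
  obtain C0 d :: real where C: "1 \<le> d" "d < C0"
    and H: "\<forall>\<^sub>F x::real in at_top. \<exists>m::int.
        x - (ln (x / 2)) powr d < of_int m \<and> of_int m \<le> x \<and>
        real (omega m) \<ge> C0 * ln (ln (of_int m)) / ln (ln (ln (of_int m)))"
    using assms by blast
  \<comment> \<open>The gap between \<open>d\<close> and \<open>D\<close> absorbs the additive shift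
    \<open>r\<close>; the gap between \<open>B\<close> and \<open>C0\<close> absorbs the loss in
    passing from \<open>t\<close> to \<open>t/2\<close>. The ratio \<open>B / D\<close> is the
    gain.\<close>
  obtain D where D: "d < D" "D < C0" using C(2) dense by blast
  obtain B where B: "D < B" "B < C0" using D(2) dense by blast
  define \<delta> where "\<delta> = B / D - 1"
  have \<delta>: "\<delta> > 0" "(1 + \<delta>) * D = B" using B D C by (auto simp: \<delta>_def field_simps)
  have "\<forall>\<^sub>F n::int in at_top. \<exists>k::int. K \<le> k \<and> k < n \<and>
        real (omega (n - k)) > (1 + \<delta>) * ln (of_int k) / ln (ln (of_int k))" for K :: int
  proof -
    \<comment> \<open>\<open>K\<close> serves the required lower bound on \<open>k\<close>, 27 the
      use of \<open>exp_1_le_ln\<close>.\<close>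
    define c where "c = max K 27"
    define r where "r = real_of_int c"
    have r: "27 \<le> r" by (simp add: r_def c_def)
    have "filterlim (\<lambda>t::real. t - r) at_top at_top" by real_asymp
    from eventually_compose_filterlim[OF H this]
    have E1: "\<forall>\<^sub>F t::real in at_top. \<exists>m::int.
        (t - r) - (ln ((t - r) / 2)) powr d < of_int m \<and> of_int m \<le> t - r \<and>
        real (omega m) \<ge> C0 * ln (ln (of_int m)) / ln (ln (ln (of_int m)))" .
    have E2: "\<forall>\<^sub>F t::real in at_top. t / 2 \<le> (t - r) - (ln ((t - r) / 2)) powr d"
      using C by real_asymp
    have E3: "\<forall>\<^sub>F t::real in at_top. r + (ln ((t - r) / 2)) powr d \<le> ln t powr D"
      using C D by real_asymp
    \<comment> \<open>The two quotients are asymptotically equal, so \<open>B < C0\<close> decides;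
      the strictness of the conclusion comes from here.\<close>
    have E4: "\<forall>\<^sub>F t::real in at_top. B * (ln (ln t) / ln (ln (ln t)))
        < C0 * (ln (ln (t/2)) / ln (ln (ln (t/2))))"
      using C D B by real_asymp
    have E5: "\<forall>\<^sub>F t::real in at_top. exp 1 \<le> ln (ln (t/2))" by real_asymp
    have E6: "\<forall>\<^sub>F t::real in at_top. 1 < ln (ln t)" by real_asymp
    have E7: "\<forall>\<^sub>F t::real in at_top. 2 * exp 1 < t" by real_asymp
    \<comment> \<open>All estimates are for real \<open>t\<close>; guarding by
      \<open>t = of_int n\<close> lets the result be pulled back to integers along
      \<open>of_int\<close>.\<close>
    have "\<forall>\<^sub>F t::real in at_top. \<forall>n::int. t = of_int n \<longrightarrow> (\<exists>k::int. K \<le> k \<and> k < n \<and>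
        real (omega (n - k)) > (1 + \<delta>) * ln (of_int k) / ln (ln (of_int k)))"
      using E1 E2 E3 E4 E5 E6 E7
    proof eventually_elim
      case (elim t)
      from elim(1) obtain m :: int where
        m: "(t - r) - (ln ((t - r) / 2)) powr d < of_int m" "of_int m \<le> t - r"
        "real (omega m) \<ge> C0 * (ln (ln (of_int m)) / ln (ln (ln (of_int m))))"
        unfolding times_divide_eq_right by blast
      have tm: "t / 2 \<le> of_int m" using m(1) elim(2) by linarith
      have t0: "1 < t" using elim(7) one_less_exp_iff[of "1::real"] by linarith
      have lt: "0 < ln t" using t0 by simp
      show ?case
      proof (intro allI impI exI conjI)
        fix n :: int assume n: "t = of_int n"
        define s where "s = real_of_int (n - m)"
        have "r \<le> s" using m(2) n by (simp add: s_def)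
        then show "K \<le> n - m" by (simp add: r_def s_def c_def)
        have "0 < real_of_int m" using tm t0 by linarith
        then show "n - m < n" by simp
        have s27: "27 \<le> s" using \<open>r \<le> s\<close> r by linarith
        have "s \<le> ln t powr D" using m(1) elim(3) n by (simp add: s_def)
        then have "ln s \<le> ln (ln t powr D)" using s27 by (subst ln_le_cancel_iff) auto
        also have "\<dots> = D * ln (ln t)" using lt by simp
        finally have "ln s / ln (ln s) \<le> (D * ln (ln t)) / ln (D * ln (ln t))"
          by (intro divide_ln_mono exp_1_le_ln s27)
        \<comment> \<open>As \<open>D\<close> is at least 1, dropping it inside the logarithm only
          shrinks the positive denominator.\<close>
        also have "\<dots> \<le> D * ln (ln t) / ln (ln (ln t))"
        proof (intro divide_left_mono)
          have "1 * ln (ln t) \<le> D * ln (ln t)"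
            using elim(6) C D by (intro mult_right_mono) auto
          then show "ln (ln (ln t)) \<le> ln (D * ln (ln t))"
            using elim(6) by (subst ln_le_cancel_iff) auto
          moreover have "0 < ln (ln (ln t))" using elim(6) by simp
          ultimately show "0 < ln (D * ln (ln t)) * ln (ln (ln t))" by simp
          show "0 \<le> D * ln (ln t)" using elim(6) C D by auto
        qed
        finally have "(1 + \<delta>) * (ln s / ln (ln s)) \<le> (1 + \<delta>) * (D * ln (ln t) / ln (ln (ln t)))"
          using \<delta>(1) by (intro mult_left_mono) auto
        also have "\<dots> = B * (ln (ln t) / ln (ln (ln t)))"
          using \<delta>(2) by (simp add: mult.assoc[symmetric])
        also have "\<dots> < C0 * (ln (ln (t/2)) / ln (ln (ln (t/2))))" by (rule elim(4))
        \<comment> \<open>Here \<open>m\<close> is at least \<open>t/2\<close>, and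
          \<open>E5\<close> places \<open>ln (ln (t/2))\<close> in the increasing range.\<close>
        also have "\<dots> \<le> C0 * (ln (ln (of_int m)) / ln (ln (ln (of_int m))))"
        proof (intro mult_left_mono divide_ln_mono elim(5))
          have "ln (t / 2) \<le> ln (of_int m)" using tm t0 by (subst ln_le_cancel_iff) auto
          moreover have "0 < ln (t / 2)"
            using elim(7) one_less_exp_iff[of "1::real"] by (intro ln_gt_zero) linarith
          ultimately show "ln (ln (t / 2)) \<le> ln (ln (of_int m))" by simp
          show "0 \<le> C0" using C by linarith
        qed
        also have "\<dots> \<le> real (omega m)" by (rule m(3))
        finally show "real (omega (n - (n - m)))
            > (1 + \<delta>) * ln (of_int (n - m)) / ln (ln (of_int (n - m)))"
          by (simp add: s_def)
      qed
    qed
    from eventually_compose_filterlim[OF this filterlim_real_of_int_at_top]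
    show ?thesis by simp
  qed
  with \<delta>(1) show ?thesis by blast
qed

end
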